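(* Let $\mathcal{PB}_2^h(x,E)$ be the Piterbarg-Berman function with drift function $h(t)=c|t|^\lambda-t^2$, $c>0$, $\lambda\ge1$, and $E=[a,b]$, $a<b$, $b>0$, $x\in[0,b-a]$. (i) For $a\ge0$, $$ \begin{aligned} \mathcal{PB}_2^h(x,E)=\ &\mathbb E\big\{\mathbb I\big(\sqrt2\,\mathcal N(a+x)+\mathcal W>c(a+x)^\lambda\big)\big\}\\ &+\int_0^\infty e^z\,\mathbb P\{\min(b,t_2)-\max(a,t_1)>x,\ f_{\mathcal N}(t^* )<0,\ \mathcal N>0\}\,dz . \end{aligned} $$ (ii) For $a<0$, $$ \begin{aligned} \mathcal{PB}_2^h(x,E)=&\int_{\mathbb R}e^z\Big[\mathbb P\{f_{\mathcal N}(a+x)<0,\ f_{\mathcal N}'(a)\ge0\}+\mathbb P\{f_{\mathcal N}(b-x)<0,\ f_{\mathcal N}'(b)\le0\}\Big]dz\\ &+\int_{\mathbb R}e^z\,\mathbb P\{\min(b,t_2)-\max(a,t_1)>x,\ f_{\mathcal N}'(a)<0<f_{\mathcal N}'(b),\ f_{\mathcal N}(t^* )<0\}\,dz . \end{aligned} $$ Here $t_1<t_2$ are the two random solutions of $f_{\mathcal N}(t)=0$, $t\in\mathbb R$, when its minimum $f_{\mathcal N}(t^* )$ is less than zero.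
   Context: Let $\mathcal N\sim N(0,1)$ and let $\mathcal W$ be a standard exponential random variable independent of $\mathcal N$. For an interval $E$ and a drift function $h$ continuous on $E$, the Piterbarg-Berman function is $$\mathcal{PB}_2^h(x,E)=\int_{\mathbb R}e^z\,\mathbb P\Big\{\int_E\mathbb I\big(\sqrt2\,\mathcal N t-t^2-h(t)-z>0\big)\,dt>x\Big\}\,dz,\qquad x\in[0,\mathrm{mes}(E)].$$ For $z\in\mathbb R$, $f_{\mathcal N}(t)=f_{\mathcal N}(t,z)=h(t)+t^2-\sqrt2\,\mathcal N t+z=c|t|^\lambda-\sqrt2\,\mathcal N t+z$, so that $f_{\mathcal N}'(t)=\lambda c|t|^{\lambda-1}\mathrm{sign}(t)-\sqrt2\,\mathcal N$ for $t\ne0$, and $f_{\mathcal N}(t^* )=\min_{t\in\mathbb R}f_{\mathcal N}(t)$.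
   Formalization: The endpoint x=b-a is excluded: there the left side is 0 while the right sides are strictly positive. For λ=1, where f_N may be unbounded below with one zero, f_N(t* ) is the infimum (possibly −∞) and the missing root t_1 or t_2 is −∞ or +∞. *)

theory Defs
  imports "HOL-Probability.Probability" "HOL-Real_Asymp.Real_Asymp"
begin

text \<open>The law of \<open>N\<close> under \<open>M\<close> is meant to be standard normal; this is an assumption of the
  theorems, not part of the definition. The value lives in \<open>ennreal\<close>, so that no
  integrability side conditions are hidden in it.\<close>

definition PB2 ::
  "'a measure \<Rightarrow> ('a \<Rightarrow> real) \<Rightarrow> (real \<Rightarrow> real) \<Rightarrow> real \<Rightarrow> real set \<Rightarrow> ennreal" where
  "PB2 M N h x E =
     (\<integral>\<^sup>+ z. ennreal (exp z *
        \<P>(\<omega> in M. (\<integral>\<^sup>+ t \<in> E. indicator {t. sqrt 2 * N \<omega> * t - t\<^sup>2 - h t - z > 0} t \<partial>lborel)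
                   > ennreal x)) \<partial>lborel)"

text \<open>At the right end of the range of \<open>x\<close> the inner event is empty. The right-hand sides of the
  formulas for \<open>PB2\<close> with \<open>E = {a..b}\<close> stay positive there (they give the left limit), so
  these formulas concern \<open>x < b - a\<close> only.\<close>

lemma PB2_full_length:
  assumes "a \<le> b"
  shows "PB2 M N h (b - a) {a..b} = 0"
proof -
  have "\<not> (\<integral>\<^sup>+ t \<in> {a..b}. indicator A t \<partial>lborel) > ennreal (b - a)" for A :: "real set"
  proof -
    have "(\<integral>\<^sup>+ t \<in> {a..b}. indicator A t \<partial>lborel) \<le> (\<integral>\<^sup>+ t. indicator {a..b} t \<partial>lborel)"
      by (intro nn_integral_mono) (auto simp: indicator_def)
    also have "\<dots> = ennreal (b - a)" using assms by simp
    finally show ?thesis by (simp add: not_less)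
  qed
  then show ?thesis by (simp add: PB2_def)
qed

definition drift :: "real \<Rightarrow> real \<Rightarrow> real \<Rightarrow> real" where
  "drift c lam t = c * \<bar>t\<bar> powr lam - t\<^sup>2"

text \<open>\<open>fN h u z\<close> is the random function of the theorems on the event that the normal variable
  takes the value \<open>u\<close>.\<close>

definition fN :: "(real \<Rightarrow> real) \<Rightarrow> real \<Rightarrow> real \<Rightarrow> real \<Rightarrow> real" where
  "fN h u z t = h t + t\<^sup>2 - sqrt 2 * u * t + z"

text \<open>The minimum over the real line is taken in the extended reals: for the drift with
  \<open>lam = 1\<close> the function may be unbounded below, and the minimum then counts as \<open>-\<infinity>\<close>.\<close>

definition min_value :: "(real \<Rightarrow> real) \<Rightarrow> ereal" where
  "min_value f = (INF t. ereal (f t))"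

text \<open>The two solutions of \<open>f t = 0\<close> for a convex \<open>f\<close> with negative minimum: the one to the left
  and the one to the right of the region where \<open>f\<close> is negative. If there is no solution on one
  side, which for the drift above happens only when \<open>lam = 1\<close>, then \<open>Sup {} = -\<infinity>\<close> and
  \<open>Inf {} = \<infinity>\<close> give the endpoint of the (then unbounded) negativity region. See
  \<open>two_solutions\<close> below for \<open>lam > 1\<close>.\<close>

definition left_root :: "(real \<Rightarrow> real) \<Rightarrow> ereal" where
  "left_root f = Sup (ereal ` {s. f s = 0 \<and> (\<exists>t>s. f t < 0)})"

definition right_root :: "(real \<Rightarrow> real) \<Rightarrow> ereal" where
  "right_root f = Inf (ereal ` {s. f s = 0 \<and> (\<exists>t<s. f t < 0)})"

lemma fN_drift: "fN (drift c lam) u z t = c * \<bar>t\<bar> powr lam - sqrt 2 * u * t + z"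
  by (simp add: fN_def drift_def)

lemma deriv_fN_drift:
  assumes "t \<noteq> 0"
  shows "deriv (fN (drift c lam) u z) t = lam * c * \<bar>t\<bar> powr (lam - 1) * sgn t - sqrt 2 * u"
proof -
  have eq: "fN (drift c lam) u z = (\<lambda>t. c * \<bar>t\<bar> powr lam - sqrt 2 * u * t + z)"
    by (simp add: fN_drift fun_eq_iff)
  have "((\<lambda>t. c * \<bar>t\<bar> powr lam - sqrt 2 * u * t + z) has_real_derivative
      (c * (lam * \<bar>t\<bar> powr (lam - 1) * sgn t) - sqrt 2 * u)) (at t)"
  proof -
    have A: "((\<lambda>x. \<bar>x\<bar>) has_real_derivative sgn t) (at t)"
    proof (cases "t > 0")
      case True
      show ?thesis
        by (rule has_field_derivative_transform_within_open[where S = "{0<..}" and f = "\<lambda>x. x"])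
          (use True in \<open>auto intro!: derivative_eq_intros\<close>)
    next
      case False
      show ?thesis
        by (rule has_field_derivative_transform_within_open[where S = "{..<0}" and f = "\<lambda>x. - x"])
          (use False assms in \<open>auto intro!: derivative_eq_intros\<close>)
    qed
    have B: "((\<lambda>x. x powr lam) has_real_derivative (lam * \<bar>t\<bar> powr (lam - 1))) (at \<bar>t\<bar>)"
      using assms by (intro has_real_derivative_powr) simp
    have C: "((\<lambda>t. \<bar>t\<bar> powr lam) has_real_derivative (lam * \<bar>t\<bar> powr (lam - 1) * sgn t)) (at t)"
      by (rule DERIV_chain2[OF B A])
    have "((\<lambda>t. c * \<bar>t\<bar> powr lam - sqrt 2 * u * t + z) has_real_derivative
        (c * (lam * \<bar>t\<bar> powr (lam - 1) * sgn t) - sqrt 2 * u * 1 + 0)) (at t)"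
      by (intro DERIV_add DERIV_diff DERIV_cmult DERIV_ident DERIV_const C)
    then show ?thesis by simp
  qed
  then show ?thesis
    unfolding eq by (simp add: DERIV_imp_deriv algebra_simps)
qed

lemma convex_abs_powr:
  assumes "(p::real) \<ge> 1"
  shows "convex_on UNIV (\<lambda>t::real. \<bar>t\<bar> powr p)"
proof (rule convex_onI)
  fix t x y :: real assume t: "0 < t" "t < 1"
  have powr_le: "((1 - t) * u + t * v) powr p \<le> (1 - t) * u powr p + t * v powr p"
    if "u \<ge> 0" "v \<ge> 0" for u v
  proof -
    have scale: "(r * w) powr p \<le> r * w powr p" if "0 < r" "r < 1" "w \<ge> 0" for r w
    proof -
      have "r powr p \<le> r powr 1" using that assms by (intro powr_mono') auto
      then show ?thesis using that by (simp add: powr_mult mult_right_mono)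
    qed
    consider "u = 0" | "v = 0" | "u > 0" "v > 0" using \<open>u \<ge> 0\<close> \<open>v \<ge> 0\<close> by linarith
    then show ?thesis
    proof cases
      case 1 then show ?thesis using scale[of t v] t that by simp
    next
      case 2 then show ?thesis using scale[of "1 - t" u] t that by simp
    next
      case 3
      then show ?thesis
        using convex_onD[OF powr_convex[OF assms], of t u v] t by simp
    qed
  qed
  have "\<bar>(1 - t) * x + t * y\<bar> \<le> (1 - t) * \<bar>x\<bar> + t * \<bar>y\<bar>"
    using abs_triangle_ineq[of "(1 - t) * x" "t * y"] t by (simp add: abs_mult)
  then have "\<bar>(1 - t) * x + t * y\<bar> powr p \<le> ((1 - t) * \<bar>x\<bar> + t * \<bar>y\<bar>) powr p"
    using assms by (intro powr_mono2) auto
  also have "\<dots> \<le> (1 - t) * \<bar>x\<bar> powr p + t * \<bar>y\<bar> powr p" by (rule powr_le) auto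
  finally show "\<bar>(1 - t) *\<^sub>R x + t *\<^sub>R y\<bar> powr p \<le> (1 - t) * \<bar>x\<bar> powr p + t * \<bar>y\<bar> powr p"
    by simp
qed auto

lemma convex_fN_drift:
  assumes "c > 0" "lam \<ge> 1"
  shows "convex_on UNIV (fN (drift c lam) u z)"
proof (rule convex_onI)
  fix t x y :: real assume t: "0 < t" "t < 1"
  have "\<bar>(1 - t) * x + t * y\<bar> powr lam \<le> (1 - t) * \<bar>x\<bar> powr lam + t * \<bar>y\<bar> powr lam"
    using convex_onD[OF convex_abs_powr[OF assms(2)], of t x y] t by simp
  then have "c * \<bar>(1 - t) * x + t * y\<bar> powr lam \<le> c * ((1 - t) * \<bar>x\<bar> powr lam + t * \<bar>y\<bar> powr lam)"
    using assms(1) by simp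
  then show "fN (drift c lam) u z ((1 - t) *\<^sub>R x + t *\<^sub>R y)
      \<le> (1 - t) * fN (drift c lam) u z x + t * fN (drift c lam) u z y"
    by (simp add: fN_drift algebra_simps)
qed auto

lemma two_solutions:
  assumes "c > 0" "lam > 1" and neg: "min_value (fN (drift c lam) u z) < 0"
  obtains t1 t2 where
    "t1 < t2" "{t. fN (drift c lam) u z t = 0} = {t1, t2}"
    "left_root (fN (drift c lam) u z) = ereal t1" "right_root (fN (drift c lam) u z) = ereal t2"
proof -
  define f where "f = fN (drift c lam) u z"
  have cvx: "convex_on UNIV f" unfolding f_def using assms by (intro convex_fN_drift) auto
  have cont: "continuous_on A f" for A
    using convex_on_continuous[OF open_UNIV cvx] continuous_on_subset by blast
  obtain s where s: "f s < 0"
    using neg unfolding min_value_def INF_less_iff zero_ereal_def f_def by auto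
  have pos: "\<exists>r>B. c * r powr lam - q * r + z > 0" for q B
  proof -
    have "filterlim (\<lambda>r. c * r powr lam - q * r + z) at_top at_top"
      using assms(1,2) by real_asymp
    then have "eventually (\<lambda>r. c * r powr lam - q * r + z > 0) at_top"
      by (simp add: filterlim_at_top_dense)
    with eventually_gt_at_top[of B] have "eventually (\<lambda>r. r > B \<and> c * r powr lam - q * r + z > 0) at_top"
      by eventually_elim simp
    then obtain R where "\<forall>r\<ge>R. r > B \<and> c * r powr lam - q * r + z > 0"
      unfolding eventually_at_top_linorder by (rule exE)
    then show ?thesis by (intro exI[of _ R]) simp
  qed
  obtain r where r: "r > s" "f r > 0"
  proof -
    obtain q where "q > \<bar>s\<bar>" "c * q powr lam - sqrt 2 * u * q + z > 0"
      using pos[of "\<bar>s\<bar>" "sqrt 2 * u"] by blast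
    then show thesis by (intro that[of q]) (auto simp: f_def fN_drift)
  qed
  obtain l where l: "l < s" "f l > 0"
  proof -
    obtain q where "q > \<bar>s\<bar>" "c * q powr lam - - (sqrt 2 * u) * q + z > 0"
      using pos[of "\<bar>s\<bar>" "- (sqrt 2 * u)"] by blast
    then show thesis by (intro that[of "- q"]) (auto simp: f_def fN_drift)
  qed
  obtain t1 where t1: "l \<le> t1" "t1 \<le> s" "f t1 = 0"
    using IVT2'[OF less_imp_le[OF s] less_imp_le[OF l(2)] less_imp_le[OF l(1)] cont] by blast
  obtain t2 where t2: "s \<le> t2" "t2 \<le> r" "f t2 = 0"
    using IVT'[OF less_imp_le[OF s] less_imp_le[OF r(2)] less_imp_le[OF r(1)] cont] by blast
  have ne: "t1 < s" "s < t2" using s t1 t2 by (auto simp: less_le)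
  have between: "f y < 0" if "f x < 0" "f w \<le> 0" "x < y \<and> y < w \<or> w < y \<and> y < x" for x y w
  proof -
    define k where "k = (y - x) / (w - x)"
    have k: "0 < k" "k < 1" using that by (auto simp: k_def field_simps)
    have "k * (w - x) = y - x" using that by (auto simp: k_def)
    then have y: "y = (1 - k) * x + k * w" by (simp add: algebra_simps)
    have "f y \<le> (1 - k) * f x + k * f w"
      using convex_onD[OF cvx, of k x w] k unfolding y by simp
    moreover have "(1 - k) * f x < 0" "k * f w \<le> 0"
      using k that by (auto simp: mult_less_0_iff mult_le_0_iff)
    ultimately show ?thesis by linarith
  qed
  have zeros: "x = t1 \<or> x = t2" if "f x = 0" for x
  proof (rule ccontr)
    assume "\<not> (x = t1 \<or> x = t2)"
    then have "x < t1 \<or> t1 < x \<and> x < s \<or> x = s \<or> s < x \<and> x < t2 \<or> t2 < x" by auto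
    then show False
      using between[of s x t1] between[of s t1 x] between[of s x t2] between[of s t2 x]
        that s ne t1(3) t2(3) by (smt (verit))
  qed
  have noL: "\<not> f t < 0" if "t < t1 \<or> t > t2" for t
    using between[of t t2 t1] between[of t t1 t2] that ne t1(3) t2(3) by (smt (verit))
  have L: "{x. f x = 0 \<and> (\<exists>t>x. f t < 0)} = {t1}" (is "?A = _")
  proof
    show "?A \<subseteq> {t1}"
    proof
      fix x assume "x \<in> ?A"
      then obtain t where "f x = 0" "t > x" "f t < 0" by blast
      then show "x \<in> {t1}" using zeros[of x] noL[of t] by blast
    qed
    show "{t1} \<subseteq> ?A" using t1(3) ne(1) s by blast
  qed
  have R: "{x. f x = 0 \<and> (\<exists>t<x. f t < 0)} = {t2}" (is "?A = _")
  proof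
    show "?A \<subseteq> {t2}"
    proof
      fix x assume "x \<in> ?A"
      then obtain t where "f x = 0" "t < x" "f t < 0" by blast
      then show "x \<in> {t2}" using zeros[of x] noL[of t] by blast
    qed
    show "{t2} \<subseteq> ?A" using t2(3) ne(2) s by blast
  qed
  have Z: "{t. f t = 0} = {t1, t2}" using zeros t1(3) t2(3) by blast
  have "left_root f = ereal t1" unfolding left_root_def L by simp
  moreover have "right_root f = ereal t2" unfolding right_root_def R by simp
  ultimately show thesis
    using that[of t1 t2] less_trans[OF ne] Z unfolding f_def by blast
qed

end

theory Submission
  imports Defs
begin

text \<open>For fixed values of the normal variable and of \<open>z\<close> the function \<open>f\<close> is convex, so \<open>f < 0\<close>
  holds exactly between its two roots, and the sojourn time in \<open>{a..b}\<close> is the length of an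
  interval. If moreover \<open>f a < 0\<close> whenever \<open>f\<close> is negative somewhere to the right of \<open>a\<close>, that
  interval starts at \<open>a\<close> and is longer than \<open>x\<close> iff \<open>f (a + x) < 0\<close>.

  For \<open>a \<ge> 0\<close> and \<open>z < 0\<close> this is the case because \<open>f 0 = z < 0\<close>; there \<open>e\<^sup>z\<close> is the density of
  \<open>- W\<close>, which turns the integral over \<open>z < 0\<close> into a probability. For \<open>z \<ge> 0\<close> the function \<open>f\<close>
  is negative somewhere on the positive half-line only if \<open>N > 0\<close>. For \<open>a < 0\<close> one distinguishes
  \<open>f' a \<ge> 0\<close>, \<open>f' b \<le> 0\<close> and \<open>f' a < 0 < f' b\<close>, which exclude each other because
  \<open>f' a < f' b\<close>.\<close>

section \<open>Negativity sets and roots of convex functions\<close>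

lemma convex_neg_between:
  fixes f :: "real \<Rightarrow> real"
  assumes "convex_on UNIV f" "f x < 0" "f w \<le> 0" "y \<in> closed_segment x w" "y \<noteq> w"
  shows "f y < 0"
proof -
  obtain k where k: "0 \<le> k" "k \<le> 1" and y: "y = (1 - k) * x + k * w"
    using assms(4) by (auto simp: in_segment)
  \<comment> \<open>Since \<open>y \<noteq> w\<close>, the point \<open>x\<close> has positive
    weight, so strictness survives even if \<open>f w = 0\<close>.\<close>
  have "k \<noteq> 1" using y assms(5) by auto
  then have "(1 - k) * f x < 0" "k * f w \<le> 0"
    using k assms(2,3) by (auto simp: mult_less_0_iff mult_le_0_iff)
  moreover have "f y \<le> (1 - k) * f x + k * f w"
    using convex_onD[OF assms(1), of k x w] k unfolding y by simp
  ultimately show ?thesis by linarith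
qed

text \<open>Used to derive statements about right roots and right endpoints from those about left
  ones.\<close>

lemma convex_on_reflect:
  fixes f :: "real \<Rightarrow> real"
  assumes "convex_on UNIV f"
  shows "convex_on UNIV (\<lambda>t. f (- t))"
proof (rule convex_onI)
  fix t x y :: real assume "0 < t" "t < 1"
  then show "f (- ((1 - t) *\<^sub>R x + t *\<^sub>R y)) \<le> (1 - t) * f (- x) + t * f (- y)"
    using convex_onD[OF assms, of t "- x" "- y"] by (simp add: algebra_simps)
qed auto

lemma convex_continuous_UNIV:
  fixes f :: "real \<Rightarrow> real"
  assumes "convex_on UNIV f"
  shows "continuous_on A f"
  using convex_on_continuous[OF open_UNIV assms] continuous_on_subset by blast

lemma neg_nbhd:
  fixes f :: "real \<Rightarrow> real"
  assumes "convex_on UNIV f" "f t < 0"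
  obtains d where "d > 0" "\<And>y. \<bar>y - t\<bar> \<le> d \<Longrightarrow> f y < 0"
proof -
  have "open {y. f y < 0}"
    using convex_continuous_UNIV[OF assms(1)] by (intro open_Collect_less) auto
  then obtain e where e: "e > 0" "cball t e \<subseteq> {y. f y < 0}"
    using assms(2) open_contains_cball by (metis mem_Collect_eq)
  show thesis
    by (rule that[OF e(1)]) (use e(2) in \<open>auto simp: subset_iff dist_real_def abs_minus_commute\<close>)
qed

text \<open>A zero \<open>p > t - d\<close> with a negative point \<open>q\<close> to its right
  would lie between the negative points \<open>t - d\<close> and \<open>q\<close>. So all zeros in
  the supremum stay below \<open>t\<close> by at least \<open>d\<close>, which makes the inequality
  strict.\<close>

lemma left_root_less:
  assumes cvx: "convex_on UNIV f" and t: "f t < 0"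
  shows "left_root f < ereal t"
proof -
  obtain d where d: "d > 0" "\<And>y. \<bar>y - t\<bar> \<le> d \<Longrightarrow> f y < 0"
    using neg_nbhd[OF cvx t] by blast
  have "p \<le> t - d" if "f p = 0" "q > p" "f q < 0" for p q
    using convex_neg_between[OF cvx, of "t - d" q p] d(2)[of "t - d"] d(1) that
    by (cases "p \<le> t - d") (auto simp: closed_segment_eq_real_ivl)
  then have "left_root f \<le> ereal (t - d)"
    unfolding left_root_def by (intro Sup_least) auto
  also have "\<dots> < ereal t" using d(1) by simp
  finally show ?thesis .
qed

text \<open>The two defining sets are mirror images, and negation exchanges \<open>Sup\<close> and
  \<open>Inf\<close>, also for empty sets.\<close>

lemma right_root_eq_reflect: "right_root f = - left_root (\<lambda>t. f (- t))"
proof -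
  have "(\<exists>t<s. f t < 0) \<longleftrightarrow> (\<exists>t>- s. f (- t) < 0)" for s
    by (metis minus_minus neg_less_iff_less)
  then have "{s. f s = 0 \<and> (\<exists>t<s. f t < 0)} = uminus ` {s. f (- s) = 0 \<and> (\<exists>t>s. f (- t) < 0)}"
    by (force simp: image_iff intro: exI[of _ "- _"])
  then have "ereal ` {s. f s = 0 \<and> (\<exists>t<s. f t < 0)}
      = uminus ` ereal ` {s. f (- s) = 0 \<and> (\<exists>t>s. f (- t) < 0)}"
    by (simp add: image_image)
  then show ?thesis
    unfolding right_root_def left_root_def by (simp add: ereal_Inf_uminus_image_eq)
qed

lemma right_root_greater:
  assumes "convex_on UNIV f" "f t < 0"
  shows "ereal t < right_root f"
  using left_root_less[OF convex_on_reflect[OF assms(1)], of "- t"] assms(2)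
    ereal_less_uminus_reorder[of "ereal t"]
  unfolding right_root_eq_reflect by simp

text \<open>If \<open>f t \<ge> 0\<close>, the intermediate value theorem gives a zero between
  \<open>t\<close> and \<open>s\<close>. It has the negative point \<open>s\<close> to its right, so
  \<open>left_root f\<close> is at least this zero and hence at least \<open>t\<close>.\<close>

lemma neg_if_left_root_less:
  assumes cvx: "convex_on UNIV f" and s: "f s < 0" and t: "left_root f < ereal t" "t \<le> s"
  shows "f t < 0"
proof (rule ccontr)
  assume "\<not> f t < 0"
  then obtain p where p: "t \<le> p" "p \<le> s" "f p = 0"
    using IVT2'[of f s 0 t] s t(2) convex_continuous_UNIV[OF cvx] by auto
  with s have "p < s" by (auto simp: less_le)
  then have "ereal p \<le> left_root f"
    unfolding left_root_def using p s by (intro Sup_upper) auto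
  with t(1) p(1) show False
    by (meson ereal_less_eq(3) leD le_less_trans less_le_trans)
qed

text \<open>Infinite roots are included, so \<open>lam = 1\<close> is treated together with
  \<open>lam > 1\<close>.\<close>

lemma neg_set_eq_between_roots:
  assumes cvx: "convex_on UNIV f" and s: "f s < 0"
  shows "f t < 0 \<longleftrightarrow> left_root f < ereal t \<and> ereal t < right_root f"
proof
  assume *: "left_root f < ereal t \<and> ereal t < right_root f"
  show "f t < 0"
  proof (cases "t \<le> s")
    case True
    then show ?thesis using neg_if_left_root_less[OF cvx s] * by simp
  next
    case False
    have "left_root (\<lambda>t. f (- t)) < ereal (- t)"
      using * ereal_less_uminus_reorder[of "ereal t"] by (simp add: right_root_eq_reflect)
    then show ?thesis
      using neg_if_left_root_less[OF convex_on_reflect[OF cvx], of "- s" "- t"] s False by simp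
  qed
qed (use left_root_less[OF cvx] right_root_greater[OF cvx] in auto)

section \<open>Length of the negativity set in a bounded interval\<close>

lemma sets_neg:
  fixes f :: "real \<Rightarrow> real"
  assumes "convex_on UNIV f"
  shows "{t \<in> {a..b}. f t < 0} \<in> sets lborel"
proof -
  have [measurable]: "f \<in> borel_measurable borel"
    using convex_continuous_UNIV[OF assms] by (rule borel_measurable_continuous_onI)
  show ?thesis by measurable
qed

text \<open>Up to endpoints the negativity set in \<open>{a..b}\<close> is the interval from the
  maximum to the minimum. The condition on \<open>min_value\<close> settles the case that
  \<open>f\<close> is nowhere negative, whatever the roots are then.\<close>

lemma neg_length_gt_iff_roots:
  assumes cvx: "convex_on UNIV f" and x: "0 \<le> x"
  shows "ennreal x < emeasure lborel {t \<in> {a..b}. f t < 0} \<longleftrightarrow>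
    min (ereal b) (right_root f) - max (ereal a) (left_root f) > ereal x \<and> min_value f < 0"
proof (cases "\<exists>s. f s < 0")
  case False
  then have "0 \<le> min_value f"
    unfolding min_value_def by (intro INF_greatest) (auto simp: not_less)
  moreover from False have "{t \<in> {a..b}. f t < 0} = {}" by blast
  ultimately show ?thesis by (simp only: emeasure_empty) auto
next
  case True
  then obtain s where s: "f s < 0" by blast
  have min: "min_value f < 0"
    unfolding min_value_def INF_less_iff using s by (auto intro!: exI[of _ s])
  \<comment> \<open>\<open>left_root f\<close> may be \<open>-\<infinity>\<close> but is below
    \<open>s\<close>, so its maximum with \<open>a\<close> is finite.\<close>
  obtain l where l: "max (ereal a) (left_root f) = ereal l"
    using left_root_less[OF cvx s] by (cases "left_root f") (auto simp flip: ereal_max)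
  obtain r where r: "min (ereal b) (right_root f) = ereal r"
    using right_root_greater[OF cvx s] by (cases "right_root f") (auto simp flip: ereal_min)
  let ?T = "{t \<in> {a..b}. f t < 0}"
  have sub: "?T \<subseteq> {l..r}" "{l<..<r} \<subseteq> ?T"
  proof safe
    fix t assume t: "t \<in> {a..b}" "f t < 0"
    then have "max (ereal a) (left_root f) \<le> ereal t" "ereal t \<le> min (ereal b) (right_root f)"
      using neg_set_eq_between_roots[OF cvx s, of t] by auto
    then show "t \<in> {l..r}" unfolding l r by simp
  next
    fix t assume "t \<in> {l<..<r}"
    then have "max (ereal a) (left_root f) < ereal t" "ereal t < min (ereal b) (right_root f)"
      unfolding l r by auto
    then show "t \<in> {a..b}" "f t < 0"
      using neg_set_eq_between_roots[OF cvx s, of t] by auto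
  qed
  have "emeasure lborel ?T \<le> emeasure lborel {l..r}" using sub by (intro emeasure_mono) auto
  moreover have "emeasure lborel {l<..<r} \<le> emeasure lborel ?T"
    using sub sets_neg[OF cvx] by (intro emeasure_mono) auto
  \<comment> \<open>For \<open>l > r\<close> the upper bound is zero, and so is
    \<open>ennreal (r - l)\<close>.\<close>
  ultimately have "emeasure lborel ?T = ennreal (r - l)"
    by (cases "l \<le> r") (auto simp: ennreal_neg intro: antisym)
  then show ?thesis unfolding l r using min x by (simp add: ennreal_less_iff)
qed

text \<open>By \<open>left\<close> and convexity the negativity set in \<open>{a..b}\<close> is
  empty or an interval starting at \<open>a\<close>. If it contains \<open>a + x\<close>, continuity
  extends it further, so its length exceeds \<open>x\<close> strictly.\<close>

lemma neg_length_gt_iff_left: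
  fixes f :: "real \<Rightarrow> real"
  assumes cvx: "convex_on UNIV f" and x: "0 \<le> x" "x < b - a"
    and left: "\<And>t. a \<le> t \<Longrightarrow> f t < 0 \<Longrightarrow> f a < 0"
  shows "ennreal x < emeasure lborel {t \<in> {a..b}. f t < 0} \<longleftrightarrow> f (a + x) < 0"
proof
  have down: "f y < 0" if "a \<le> y" "y \<le> t" "f t < 0" for y t
    using convex_neg_between[OF cvx, of a t y] left[of t] that
    by (cases "y = t") (auto simp: closed_segment_eq_real_ivl)
  assume "f (a + x) < 0"
  then obtain d where d: "d > 0" "\<And>y. \<bar>y - (a + x)\<bar> \<le> d \<Longrightarrow> f y < 0"
    using neg_nbhd[OF cvx] by blast
  \<comment> \<open>The cut at \<open>b - a - x\<close> keeps \<open>a + x + e\<close> inside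
    \<open>{a..b}\<close>; it is positive as \<open>x < b - a\<close>.\<close>
  define e where "e = min d (b - a - x)"
  have e: "e > 0" "f (a + x + e) < 0" "a + x + e \<le> b" using d x by (auto simp: e_def)
  have "ennreal x < ennreal (x + e)" using e(1) x by (simp add: ennreal_less_iff)
  also have "\<dots> = emeasure lborel {a..a + x + e}" using x e by simp
  also have "\<dots> \<le> emeasure lborel {t \<in> {a..b}. f t < 0}"
    using e x down[of _ "a + x + e"] sets_neg[OF cvx] by (intro emeasure_mono) auto
  finally show "ennreal x < emeasure lborel {t \<in> {a..b}. f t < 0}" .
next
  assume *: "ennreal x < emeasure lborel {t \<in> {a..b}. f t < 0}"
  show "f (a + x) < 0"
  proof (rule ccontr)
    assume n: "\<not> f (a + x) < 0"
    \<comment> \<open>Otherwise \<open>a + x\<close> lies between the negative points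
      \<open>a\<close> and \<open>t\<close>.\<close>
    have "t \<le> a + x" if "a \<le> t" "f t < 0" for t
    proof (rule ccontr)
      assume "\<not> t \<le> a + x"
      then show False
        using convex_neg_between[OF cvx, of a t "a + x"] left[OF that] that n x
        by (auto simp: closed_segment_eq_real_ivl)
    qed
    then have "{t \<in> {a..b}. f t < 0} \<subseteq> {a..a + x}" by auto
    then have "emeasure lborel {t \<in> {a..b}. f t < 0} \<le> emeasure lborel {a..a + x}"
      by (intro emeasure_mono) auto
    with * x show False by simp
  qed
qed

lemma neg_length_reflect:
  fixes f :: "real \<Rightarrow> real"
  assumes "convex_on UNIV f"
  shows "emeasure lborel {t \<in> {- b..- a}. f (- t) < 0} = emeasure lborel {t \<in> {a..b}. f t < 0}"
proof -
  have "emeasure lborel {t \<in> {a..b}. f t < 0}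
      = emeasure (distr lborel borel uminus) {t \<in> {a..b}. f t < 0}"
    by (simp add: lborel_distr_uminus)
  also have "\<dots> = emeasure lborel {t \<in> {- b..- a}. f (- t) < 0}"
    using sets_neg[OF assms, of a b]
    by (subst emeasure_distr) (auto intro!: arg_cong[where f = "emeasure lborel"])
  finally show ?thesis by simp
qed

lemma neg_length_gt_iff_right:
  fixes f :: "real \<Rightarrow> real"
  assumes cvx: "convex_on UNIV f" and x: "0 \<le> x" "x < b - a"
    and right: "\<And>t. t \<le> b \<Longrightarrow> f t < 0 \<Longrightarrow> f b < 0"
  shows "ennreal x < emeasure lborel {t \<in> {a..b}. f t < 0} \<longleftrightarrow> f (b - x) < 0"
proof -
  have "ennreal x < emeasure lborel {t \<in> {- b..- a}. f (- t) < 0} \<longleftrightarrow> f (- (- b + x)) < 0"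
    by (rule neg_length_gt_iff_left[OF convex_on_reflect[OF cvx]])
      (use x right in \<open>simp_all, metis minus_le_iff\<close>)
  then show ?thesis unfolding neg_length_reflect[OF cvx] by simp
qed

section \<open>Reduction of \<open>PB2\<close> to lengths, measurability, and the exponential
  weight\<close>

lemma PB2_eq_neg_length:
  assumes "c > 0" "lam \<ge> 1"
  shows "PB2 M N (drift c lam) x {a..b} = (\<integral>\<^sup>+ z. ennreal (exp z *
    \<P>(\<omega> in M. ennreal x < emeasure lborel {t \<in> {a..b}. fN (drift c lam) (N \<omega>) z t < 0})) \<partial>lborel)"
proof -
  have "(\<integral>\<^sup>+ t \<in> {a..b}. indicator {t. sqrt 2 * u * t - t\<^sup>2 - drift c lam t - z > 0} t \<partial>lborel)
      = emeasure lborel {t \<in> {a..b}. fN (drift c lam) u z t < 0}" for u z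
  proof -
    have "(\<integral>\<^sup>+ t \<in> {a..b}. indicator {t. sqrt 2 * u * t - t\<^sup>2 - drift c lam t - z > 0} t \<partial>lborel)
        = (\<integral>\<^sup>+ t. indicator {t \<in> {a..b}. fN (drift c lam) u z t < 0} t \<partial>lborel)"
      by (intro nn_integral_cong) (auto simp: fN_def indicator_def)
    also have "\<dots> = emeasure lborel {t \<in> {a..b}. fN (drift c lam) u z t < 0}"
      by (intro nn_integral_indicator sets_neg convex_fN_drift assms)
    finally show ?thesis .
  qed
  then show ?thesis unfolding PB2_def by simp
qed

text \<open>The length is the measure of a section of a measurable set in the space of triples
  \<open>((z, u), t)\<close>.\<close>

lemma measurable_neg_length [measurable]:
  "(\<lambda>p. emeasure lborel {t \<in> {a..b}. fN (drift c lam) (snd p) (fst p) t < 0})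
    \<in> borel_measurable (borel \<Otimes>\<^sub>M borel)"
proof -
  let ?Q = "{q \<in> space ((borel \<Otimes>\<^sub>M borel) \<Otimes>\<^sub>M lborel).
    snd q \<in> {a..b} \<and> fN (drift c lam) (snd (fst q)) (fst (fst q)) (snd q) < 0}"
  have "?Q \<in> sets ((borel \<Otimes>\<^sub>M borel) \<Otimes>\<^sub>M lborel)"
    unfolding fN_drift by measurable
  from lborel.measurable_emeasure_Pair[OF this] show ?thesis
    by (rule measurable_cong[THEN iffD1, rotated])
      (auto simp: space_pair_measure intro!: arg_cong[where f = "emeasure lborel"])
qed

text \<open>Needed to split the integrals over \<open>z\<close>; the events are sections of a
  measurable set in the product of the line with \<open>M\<close>.\<close>

lemma (in prob_space) borel_measurable_prob_pred:
  assumes [measurable]: "N \<in> borel_measurable M"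
    and Q: "Measurable.pred (borel \<Otimes>\<^sub>M borel) (\<lambda>p. Q (fst p) (snd p))"
  shows "(\<lambda>z. \<P>(\<omega> in M. Q z (N \<omega>))) \<in> borel_measurable borel"
proof -
  have "(\<lambda>p. (fst p, N (snd p))) \<in> borel \<Otimes>\<^sub>M M \<rightarrow>\<^sub>M borel \<Otimes>\<^sub>M borel" by measurable
  from measurable_compose[OF this Q]
  have "{p \<in> space (borel \<Otimes>\<^sub>M M). Q (fst p) (N (snd p))} \<in> sets (borel \<Otimes>\<^sub>M M)"
    by (simp add: pred_def)
  from measurable_emeasure_Pair[OF this]
  have "(\<lambda>z. emeasure M {\<omega> \<in> space M. Q z (N \<omega>)}) \<in> borel_measurable borel"
    by (rule measurable_cong[THEN iffD1, rotated])
      (auto simp: space_pair_measure intro!: arg_cong[where f = "emeasure M"])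
  then show ?thesis unfolding measure_def by measurable
qed

text \<open>Given \<open>W = y\<close>, the event on the right is \<open>- y < X\<close>; the
  substitution \<open>z = - y\<close> turns the density \<open>exp (- y)\<close> on
  \<open>y > 0\<close> into the weight \<open>exp z\<close> on \<open>z < 0\<close>.\<close>

lemma (in prob_space) nn_integral_exp_prob_less:
  assumes indep: "indep_var borel X borel W"
    and W: "distributed M lborel W (\<lambda>y. ennreal (exponential_density 1 y))"
  shows "(\<integral>\<^sup>+ z \<in> {..<0}. ennreal (exp z * \<P>(\<omega> in M. z < X \<omega>)) \<partial>lborel)
    = ennreal \<P>(\<omega> in M. 0 < X \<omega> + W \<omega>)"
proof -
  note [measurable] = indep_var_rv1[OF indep] indep_var_rv2[OF indep]
  have [measurable]: "(\<lambda>z. \<P>(\<omega> in M. z < X \<omega>)) \<in> borel_measurable borel"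
    by (rule borel_measurable_prob_pred) measurable
  define F where "F z = ennreal (exp z * \<P>(\<omega> in M. z < X \<omega>)) * indicator {..<0} z" for z
  have [measurable]: "F \<in> borel_measurable borel" unfolding F_def by measurable
  interpret X: prob_space "distr M borel X" by (rule prob_space_distr) simp
  interpret W: prob_space "distr M borel W" by (rule prob_space_distr) simp
  interpret P: pair_prob_space "distr M borel X" "distr M borel W" ..
  let ?A = "{p \<in> space (borel \<Otimes>\<^sub>M borel). 0 < fst p + snd p} :: (real \<times> real) set"
  have A [measurable]: "?A \<in> sets (borel \<Otimes>\<^sub>M borel)" by measurable
  have "distr M borel W = distr M lborel W" by (rule distr_cong) auto
  then have dW: "distr M borel W = density lborel (\<lambda>y. ennreal (exponential_density 1 y))"
    using W by (simp add: distributed_def)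
  have fibre: "emeasure (distr M borel X) ((\<lambda>x. (x, y)) -` ?A) = ennreal \<P>(\<omega> in M. - y < X \<omega>)" for y
  proof -
    have "(\<lambda>x. (x, y)) -` ?A = {- y<..}" by (auto simp: space_pair_measure)
    then show ?thesis
      by (auto simp: emeasure_distr emeasure_eq_measure intro!: arg_cong[where f = prob])
  qed
  have "ennreal \<P>(\<omega> in M. 0 < X \<omega> + W \<omega>) =
      emeasure (distr M (borel \<Otimes>\<^sub>M borel) (\<lambda>\<omega>. (X \<omega>, W \<omega>))) ?A"
    by (subst emeasure_distr)
      (use A in \<open>auto simp: emeasure_eq_measure space_pair_measure intro!: arg_cong[where f = prob]\<close>)
  also have "\<dots> = emeasure (distr M borel X \<Otimes>\<^sub>M distr M borel W) ?A"
    using indep by (simp add: indep_var_distribution_eq)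
  also have "\<dots> = (\<integral>\<^sup>+ y. ennreal \<P>(\<omega> in M. - y < X \<omega>) \<partial>distr M borel W)"
  proof -
    have "?A \<in> sets (distr M borel X \<Otimes>\<^sub>M distr M borel W)"
      using A by (simp cong: sets_pair_measure_cong)
    then show ?thesis by (subst P.emeasure_pair_measure_alt2) (simp_all only: fibre)
  qed
  also have "\<dots> = (\<integral>\<^sup>+ y. ennreal (exponential_density 1 y) * ennreal \<P>(\<omega> in M. - y < X \<omega>) \<partial>lborel)"
    unfolding dW by (subst nn_integral_density) auto
  \<comment> \<open>At \<open>y = 0\<close> the integrands may differ: the density is
    \<open>1\<close> there, while \<open>F 0 = 0\<close>.\<close>
  also have "\<dots> = (\<integral>\<^sup>+ y. F (0 + - 1 * y) \<partial>lborel)"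
    using AE_lborel_singleton[of 0]
    by (intro nn_integral_cong_AE)
      (auto elim!: eventually_mono simp: F_def exponential_density_def indicator_def simp flip: ennreal_mult')
  also have "\<dots> = (\<integral>\<^sup>+ z. F z \<partial>lborel)"
    using nn_integral_real_affine[of F "-1" 0] by simp
  finally show ?thesis unfolding F_def by simp
qed

text \<open>The tangent inequality for convex functions needs differentiability, which a value of
  \<open>deriv\<close> does not imply. Near \<open>t\<close>, \<open>\<bar>s\<bar>\<close> is the
  linear function \<open>sgn t * s\<close>.\<close>

lemma field_differentiable_fN_drift:
  assumes "t \<noteq> 0"
  shows "fN (drift c lam) u z field_differentiable at t"
proof -
  let ?S = "{s. 0 < sgn t * s}" and ?g = "\<lambda>s. c * (sgn t * s) powr lam - sqrt 2 * u * s + z"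
  have "(?g has_real_derivative (c * (lam * (sgn t * t) powr (lam - 1) * sgn t) - sqrt 2 * u)) (at t)"
    using assms by (auto intro!: derivative_eq_intros simp: sgn_if)
  moreover have "open ?S" by (intro open_Collect_less continuous_intros)
  moreover have "t \<in> ?S" using assms by (simp add: sgn_if)
  moreover have "?g s = fN (drift c lam) u z s" if "s \<in> ?S" for s
    using that by (auto simp: fN_drift sgn_if abs_if split: if_splits)
  ultimately show ?thesis
    using has_field_derivative_transform_within_open field_differentiable_def by blast
qed

theorem proposition2p2:
  fixes M :: "'a measure" and N W :: "'a \<Rightarrow> real" and c lam a b x :: real
  assumes "prob_space M"
    and "distributed M lborel N (\<lambda>y. ennreal (std_normal_density y))"
    and "distributed M lborel W (\<lambda>y. ennreal (exponential_density 1 y))"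
    and "prob_space.indep_var M borel N borel W"
    and "c > 0" and "lam \<ge> 1"
    and "a < b" and "b > 0"
    and "0 \<le> x" and "x < b - a"
  defines "h \<equiv> drift c lam"
  defines "f \<equiv> (\<lambda>\<omega> z. fN h (N \<omega>) z)"
  defines "t1 \<equiv> (\<lambda>\<omega> z. left_root (f \<omega> z))"
  defines "t2 \<equiv> (\<lambda>\<omega> z. right_root (f \<omega> z))"
  shows
    "(a \<ge> 0 \<longrightarrow>
        PB2 M N h x {a..b} =
          ennreal (\<integral>\<omega>. indicator {\<omega>. sqrt 2 * N \<omega> * (a + x) + W \<omega> > c * (a + x) powr lam} \<omega> \<partial>M)
          + (\<integral>\<^sup>+ z \<in> {0..}. ennreal (exp z *
               \<P>(\<omega> in M. min (ereal b) (t2 \<omega> z) - max (ereal a) (t1 \<omega> z) > ereal x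
                     \<and> min_value (f \<omega> z) < 0 \<and> N \<omega> > 0)) \<partial>lborel))
     \<and>
     (a < 0 \<longrightarrow>
        PB2 M N h x {a..b} =
          (\<integral>\<^sup>+ z. ennreal (exp z *
               (\<P>(\<omega> in M. f \<omega> z (a + x) < 0 \<and> deriv (f \<omega> z) a \<ge> 0)
                + \<P>(\<omega> in M. f \<omega> z (b - x) < 0 \<and> deriv (f \<omega> z) b \<le> 0))) \<partial>lborel)
          + (\<integral>\<^sup>+ z. ennreal (exp z *
               \<P>(\<omega> in M. min (ereal b) (t2 \<omega> z) - max (ereal a) (t1 \<omega> z) > ereal x
                     \<and> deriv (f \<omega> z) a < 0 \<and> 0 < deriv (f \<omega> z) b
                     \<and> min_value (f \<omega> z) < 0)) \<partial>lborel))"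
proof -
  interpret prob_space M by fact
  note [measurable] = indep_var_rv1[OF assms(4)] indep_var_rv2[OF assms(4)]
  define L where "L u z = emeasure lborel {t \<in> {a..b}. fN h u z t < 0}" for u z
  have [measurable]: "(\<lambda>p. L (snd p) (fst p)) \<in> borel_measurable (borel \<Otimes>\<^sub>M borel)"
    unfolding L_def h_def by measurable
  have cvx: "convex_on UNIV (fN h u z)" for u z
    unfolding h_def by (intro convex_fN_drift assms)
  have roots: "ennreal x < L (N \<omega>) z \<longleftrightarrow>
      min (ereal b) (t2 \<omega> z) - max (ereal a) (t1 \<omega> z) > ereal x \<and> min_value (f \<omega> z) < 0" for \<omega> z
    unfolding L_def t1_def t2_def f_def by (rule neg_length_gt_iff_roots[OF cvx \<open>0 \<le> x\<close>])
  have PB: "PB2 M N h x {a..b} = (\<integral>\<^sup>+ z. ennreal (exp z * \<P>(\<omega> in M. ennreal x < L (N \<omega>) z)) \<partial>lborel)"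
    unfolding h_def L_def by (intro PB2_eq_neg_length assms)
  show ?thesis
  proof (intro conjI impI)

    \<comment> \<open>The case \<open>a \<ge> 0\<close>: splitting the integral at
      \<open>z = 0\<close>\<close>
    assume a: "a \<ge> 0"
    \<comment> \<open>\<open>f \<omega> z\<close> is negative at \<open>a + x\<close> exactly if
      \<open>z < X \<omega>\<close>.\<close>
    define X where "X \<omega> = sqrt 2 * N \<omega> * (a + x) - c * (a + x) powr lam" for \<omega>
    have neg: "ennreal x < L u z \<longleftrightarrow> z < sqrt 2 * u * (a + x) - c * (a + x) powr lam" if "z < 0" for u z
    proof -
      have "fN h u z 0 < 0" using that by (simp add: h_def fN_drift)
      \<comment> \<open>The point \<open>a\<close> lies between the negative point \<open>0\<close>
        and any negative point \<open>t \<ge> a\<close>.\<close>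
      then have "fN h u z a < 0" if "a \<le> t" "fN h u z t < 0" for t
        using convex_neg_between[OF cvx, of u z 0 t a] that a
        by (cases "a = t") (auto simp: closed_segment_eq_real_ivl)
      then have "ennreal x < L u z \<longleftrightarrow> fN h u z (a + x) < 0"
        unfolding L_def by (intro neg_length_gt_iff_left cvx assms)
      then show ?thesis using a assms(9) by (auto simp: h_def fN_drift)
    qed
    have pos: "u > 0" if "ennreal x < L u z" "0 \<le> z" for u z
    proof (rule ccontr)
      assume "\<not> u > 0"
      \<comment> \<open>For \<open>u \<le> 0\<close>, all three terms of \<open>fN\<close> are
        nonnegative, because \<open>t \<ge> a \<ge> 0\<close>.\<close>
      have "0 \<le> fN h u z t" if "t \<in> {a..b}" for t
      proof -
        have "sqrt 2 * u * t \<le> 0" using that a \<open>\<not> u > 0\<close> by (simp add: mult_le_0_iff)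
        moreover have "0 \<le> c * \<bar>t\<bar> powr lam" using assms(5) by simp
        ultimately show ?thesis using \<open>0 \<le> z\<close> unfolding h_def fN_drift by linarith
      qed
      then have "{t \<in> {a..b}. fN h u z t < 0} = {}" by (auto simp: not_less)
      with that(1) show False unfolding L_def by (simp only: emeasure_empty) auto
    qed
    have "indep_var borel X borel W"
      using indep_var_compose[OF assms(4), of "\<lambda>u. sqrt 2 * u * (a + x) - c * (a + x) powr lam" borel id borel]
      by (simp add: X_def[abs_def] comp_def)
    note tail = nn_integral_exp_prob_less[OF this assms(3)]
    have E: "(\<integral>\<omega>. indicator {\<omega>. sqrt 2 * N \<omega> * (a + x) + W \<omega> > c * (a + x) powr lam} \<omega> \<partial>M)
        = \<P>(\<omega> in M. 0 < X \<omega> + W \<omega>)"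
      by (subst Bochner_Integration.integral_indicator) (auto simp: X_def algebra_simps intro!: arg_cong[where f = prob])
    let ?g = "\<lambda>z. ennreal (exp z * \<P>(\<omega> in M. ennreal x < L (N \<omega>) z))"
    have [measurable]: "(\<lambda>z. \<P>(\<omega> in M. ennreal x < L (N \<omega>) z)) \<in> borel_measurable borel"
      by (rule borel_measurable_prob_pred) measurable
    have "PB2 M N h x {a..b} = (\<integral>\<^sup>+ z \<in> {..<0} \<union> {0..}. ?g z \<partial>lborel)"
      unfolding PB by (intro nn_integral_cong) (auto simp: indicator_def)
    also have "\<dots> = (\<integral>\<^sup>+ z \<in> {..<0}. ?g z \<partial>lborel) + (\<integral>\<^sup>+ z \<in> {0..}. ?g z \<partial>lborel)"
      by (rule nn_integral_disjoint_pair) auto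
    also have "(\<integral>\<^sup>+ z \<in> {..<0}. ?g z \<partial>lborel) = ennreal \<P>(\<omega> in M. 0 < X \<omega> + W \<omega>)"
      unfolding tail[symmetric]
      by (intro nn_integral_cong) (auto simp: indicator_def neg X_def)
    also have "(\<integral>\<^sup>+ z \<in> {0..}. ?g z \<partial>lborel) = (\<integral>\<^sup>+ z \<in> {0..}. ennreal (exp z *
               \<P>(\<omega> in M. min (ereal b) (t2 \<omega> z) - max (ereal a) (t1 \<omega> z) > ereal x
                     \<and> min_value (f \<omega> z) < 0 \<and> N \<omega> > 0)) \<partial>lborel)"
    proof -
      have "ennreal x < L (N \<omega>) z \<longleftrightarrow> min (ereal b) (t2 \<omega> z) - max (ereal a) (t1 \<omega> z) > ereal x
                     \<and> min_value (f \<omega> z) < 0 \<and> N \<omega> > 0" if "0 \<le> z" for \<omega> z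
        using roots[of \<omega> z] pos[of "N \<omega>" z] that by blast
      then show ?thesis by (intro nn_integral_cong) (auto simp: indicator_def)
    qed
    finally show "PB2 M N h x {a..b} =
          ennreal (\<integral>\<omega>. indicator {\<omega>. sqrt 2 * N \<omega> * (a + x) + W \<omega> > c * (a + x) powr lam} \<omega> \<partial>M)
          + (\<integral>\<^sup>+ z \<in> {0..}. ennreal (exp z *
               \<P>(\<omega> in M. min (ereal b) (t2 \<omega> z) - max (ereal a) (t1 \<omega> z) > ereal x
                     \<and> min_value (f \<omega> z) < 0 \<and> N \<omega> > 0)) \<partial>lborel)"
      unfolding E .
  next

    \<comment> \<open>The case \<open>a < 0\<close>: splitting by the slopes at \<open>a\<close> and
      \<open>b\<close>\<close>
    assume a: "a < 0"
    \<comment> \<open>Changing \<open>z\<close> only shifts \<open>fN\<close> vertically, so the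
      slopes depend on \<open>u\<close> alone and may be taken at \<open>z = 0\<close>.\<close>
    define da where "da u = deriv (fN h u 0) a" for u
    define db where "db u = deriv (fN h u 0) b" for u
    have deriv_ab: "deriv (fN h u z) a = da u" "deriv (fN h u z) b = db u" for u z
      using a assms(8) by (simp_all add: da_def db_def h_def deriv_fN_drift)
    have da: "da u = - (lam * c * \<bar>a\<bar> powr (lam - 1)) - sqrt 2 * u" for u
      using a by (simp add: da_def h_def deriv_fN_drift)
    have db: "db u = lam * c * b powr (lam - 1) - sqrt 2 * u" for u
      using assms(8) by (simp add: db_def h_def deriv_fN_drift)
    \<comment> \<open>The power term decreases at \<open>a < 0\<close> and increases at
      \<open>b > 0\<close>; the linear term contributes equally to both slopes.\<close>
    have da_less_db: "da u < db u" for u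
    proof -
      have "0 < lam * c * \<bar>a\<bar> powr (lam - 1)" "0 < lam * c * b powr (lam - 1)"
        using assms a by auto
      then show ?thesis unfolding da db by linarith
    qed
    have [measurable]: "da \<in> borel_measurable borel" "db \<in> borel_measurable borel"
      unfolding da[abs_def] db[abs_def] by measurable
    \<comment> \<open>Convex functions lie above their tangents; the point \<open>0\<close> is
      excluded because of the kink there for \<open>lam = 1\<close>.\<close>
    have tangent: "deriv (fN h u z) y * (t - y) \<le> fN h u z t - fN h u z y" if "y \<noteq> 0" for u z y t
    proof -
      have "fN h u z field_differentiable at y"
        unfolding h_def by (rule field_differentiable_fN_drift[OF that])
      then have "(fN h u z has_real_derivative deriv (fN h u z) y) (at y)"
        by (rule field_differentiable_derivI)
      then show ?thesis
        by (intro convex_on_imp_above_tangent[OF cvx]) auto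
    qed
    have left: "ennreal x < L u z \<longleftrightarrow> fN h u z (a + x) < 0" if "0 \<le> da u" for u z
      unfolding L_def
    proof (intro neg_length_gt_iff_left cvx assms)
      fix t assume t: "a \<le> t" "fN h u z t < 0"
      \<comment> \<open>With nonnegative slope at \<open>a\<close> the tangent inequality gives
        \<open>fN h u z a \<le> fN h u z t\<close>.\<close>
      have "0 \<le> da u * (t - a)" using that t by simp
      with tangent[of a u z t] a t show "fN h u z a < 0" by (simp add: deriv_ab)
    qed
    have right: "ennreal x < L u z \<longleftrightarrow> fN h u z (b - x) < 0" if "db u \<le> 0" for u z
      unfolding L_def
    proof (intro neg_length_gt_iff_right cvx assms)
      fix t assume t: "t \<le> b" "fN h u z t < 0"
      \<comment> \<open>Both factors are nonpositive, so
        \<open>fN h u z b \<le> fN h u z t\<close>.\<close>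
      have "0 \<le> db u * (t - b)" using that t by (simp add: mult_nonpos_nonpos)
      with tangent[of b u z t] assms(8) t show "fN h u z b < 0" by (simp add: deriv_ab)
    qed
    define Q1 where "Q1 z u \<longleftrightarrow> fN h u z (a + x) < 0 \<and> da u \<ge> 0" for z u
    define Q2 where "Q2 z u \<longleftrightarrow> fN h u z (b - x) < 0 \<and> db u \<le> 0" for z u
    define Q3 where "Q3 z u \<longleftrightarrow> ennreal x < L u z \<and> da u < 0 \<and> 0 < db u" for z u
    have m: "Measurable.pred (borel \<Otimes>\<^sub>M borel) (\<lambda>p. Q1 (fst p) (snd p))"
      "Measurable.pred (borel \<Otimes>\<^sub>M borel) (\<lambda>p. Q2 (fst p) (snd p))"
      "Measurable.pred (borel \<Otimes>\<^sub>M borel) (\<lambda>p. Q3 (fst p) (snd p))"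
      unfolding Q1_def Q2_def Q3_def h_def fN_drift by measurable
    have Q_sets: "{\<omega> \<in> space M. Q1 z (N \<omega>)} \<in> sets M" "{\<omega> \<in> space M. Q2 z (N \<omega>)} \<in> sets M"
        "{\<omega> \<in> space M. Q3 z (N \<omega>)} \<in> sets M" for z
      using m[THEN measurable_compose[of "\<lambda>\<omega>. (z, N \<omega>)" M, rotated]]
      by (simp_all add: pred_def)
    have split: "\<P>(\<omega> in M. ennreal x < L (N \<omega>) z)
        = \<P>(\<omega> in M. Q1 z (N \<omega>)) + \<P>(\<omega> in M. Q2 z (N \<omega>)) + \<P>(\<omega> in M. Q3 z (N \<omega>))" for z
    proof -
      \<comment> \<open>If \<open>da u < 0 < db u\<close> fails, one slope condition turns the
        length condition into the sign of \<open>fN\<close> at a single point.\<close>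
      have "ennreal x < L u z \<longleftrightarrow> (Q1 z u \<or> Q2 z u) \<or> Q3 z u" for u
        using left[of u z] right[of u z] unfolding Q1_def Q2_def Q3_def by linarith
      then have eq: "{\<omega> \<in> space M. ennreal x < L (N \<omega>) z} =
          {\<omega> \<in> space M. Q1 z (N \<omega>)} \<union> {\<omega> \<in> space M. Q2 z (N \<omega>)} \<union> {\<omega> \<in> space M. Q3 z (N \<omega>)}" by auto
      \<comment> \<open>The strict inequality \<open>da u < db u\<close> separates \<open>Q1\<close>
        from \<open>Q2\<close>; the other pairs have contradictory signs.\<close>
      have "\<not> (Q1 z u \<and> Q2 z u)" "\<not> (Q1 z u \<and> Q3 z u)" "\<not> (Q2 z u \<and> Q3 z u)" for u
        using da_less_db[of u] unfolding Q1_def Q2_def Q3_def by auto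
      then show ?thesis
        unfolding eq using Q_sets[of z] by (subst finite_measure_Union, auto)+
    qed
    have [measurable]: "(\<lambda>z. \<P>(\<omega> in M. Q1 z (N \<omega>))) \<in> borel_measurable borel"
        "(\<lambda>z. \<P>(\<omega> in M. Q2 z (N \<omega>))) \<in> borel_measurable borel"
        "(\<lambda>z. \<P>(\<omega> in M. Q3 z (N \<omega>))) \<in> borel_measurable borel"
      using m[THEN borel_measurable_prob_pred[of N, rotated]] by simp_all
    have "PB2 M N h x {a..b} = (\<integral>\<^sup>+ z. ennreal (exp z * (\<P>(\<omega> in M. Q1 z (N \<omega>)) + \<P>(\<omega> in M. Q2 z (N \<omega>))))
        + ennreal (exp z * \<P>(\<omega> in M. Q3 z (N \<omega>))) \<partial>lborel)"
      unfolding PB split by (intro nn_integral_cong) (simp add: distrib_left flip: ennreal_plus)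
    also have "\<dots> = (\<integral>\<^sup>+ z. ennreal (exp z * (\<P>(\<omega> in M. Q1 z (N \<omega>)) + \<P>(\<omega> in M. Q2 z (N \<omega>)))) \<partial>lborel)
        + (\<integral>\<^sup>+ z. ennreal (exp z * \<P>(\<omega> in M. Q3 z (N \<omega>))) \<partial>lborel)"
      by (rule nn_integral_add) auto
    finally show "PB2 M N h x {a..b} =
          (\<integral>\<^sup>+ z. ennreal (exp z *
               (\<P>(\<omega> in M. f \<omega> z (a + x) < 0 \<and> deriv (f \<omega> z) a \<ge> 0)
                + \<P>(\<omega> in M. f \<omega> z (b - x) < 0 \<and> deriv (f \<omega> z) b \<le> 0))) \<partial>lborel)
          + (\<integral>\<^sup>+ z. ennreal (exp z *
               \<P>(\<omega> in M. min (ereal b) (t2 \<omega> z) - max (ereal a) (t1 \<omega> z) > ereal x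
                     \<and> deriv (f \<omega> z) a < 0 \<and> 0 < deriv (f \<omega> z) b
                     \<and> min_value (f \<omega> z) < 0)) \<partial>lborel)"
      \<comment> \<open>The length condition in \<open>Q3\<close> becomes the condition on the roots
        and the minimum.\<close>
      unfolding Q1_def Q2_def Q3_def roots by (simp add: f_def deriv_ab conj_ac)
  qed
qed

end
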